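(* Let $T$ be an $n\times n$ stochastic matrix, and let $\sigma$ denote the second smallest singular value of $I-T$. Let $S$ be the transition matrix of a completely decoupled Markov chain on $n$ states. Then $\|T-S\|_{\mathrm F}\ge\sigma$.
   Context: All matrices are real. A matrix in $\mathbb{R}^{n\times n}$ is stochastic if its entries are nonnegative and each row sums to $1$. A Markov chain, or its ($n\times n$ stochastic) transition matrix, is completely decoupled if the transition matrix is the direct sum (block diagonal matrix) of at least two stochastic matrices. $\|\cdot\|_{\mathrm F}$ is the Frobenius norm. Singular values of an $n\times n$ matrix are counted with multiplicity, $\sigma_1\ge\dots\ge\sigma_n$, so the second smallest singular value is $\sigma_{n-1}$. $I$ is the $n\times n$ identity matrix. *)

theory Defs
  imports "HOL-Computational_Algebra.Computational_Algebra" "Jordan_Normal_Form.Char_Poly"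
begin

text \<open>
  The condition \<open>0 < dim_row A\<close> excludes the empty matrix, which would otherwise be vacuously
  stochastic and would make every stochastic matrix a direct sum of two stochastic matrices.
\<close>

definition stochastic_mat :: "real mat \<Rightarrow> bool" where
  "stochastic_mat A \<longleftrightarrow>
     square_mat A \<and> 0 < dim_row A \<and>
     (\<forall>i < dim_row A. \<forall>j < dim_col A. 0 \<le> A $$ (i, j)) \<and>
     (\<forall>i < dim_row A. (\<Sum>j < dim_col A. A $$ (i, j)) = 1)"

definition completely_decoupled :: "real mat \<Rightarrow> bool" where
  "completely_decoupled S \<longleftrightarrow>
     (\<exists>Bs. 2 \<le> length Bs \<and> (\<forall>B \<in> set Bs. stochastic_mat B) \<and> S = diag_block_mat Bs)"

definition frobenius_norm :: "real mat \<Rightarrow> real" where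
  "frobenius_norm A = sqrt (\<Sum>i < dim_row A. \<Sum>j < dim_col A. (A $$ (i, j))\<^sup>2)"

text \<open>
  The square roots of the eigenvalues of \<open>A\<^sup>T A\<close>, repeated according to (algebraic) multiplicity,
  in nonincreasing order. Since \<open>A\<^sup>T A\<close> is symmetric positive semidefinite, all roots of its
  characteristic polynomial are real and nonnegative, so for an \<open>n \<times> n\<close> matrix the list has
  length \<open>n\<close>.
\<close>

definition singular_values :: "real mat \<Rightarrow> real list" where
  "singular_values A =
     rev (sorted_list_of_multiset (image_mset sqrt (proots (char_poly (transpose_mat A * A)))))"

text \<open>Numbered from 1: \<open>singular_value A 1\<close> is the largest singular value.\<close>

definition singular_value :: "real mat \<Rightarrow> nat \<Rightarrow> real" where
  "singular_value A k = singular_values A ! (k - 1)"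

end

theory Submission
  imports Defs "Jordan_Normal_Form.Spectral_Radius" "HOL-Analysis.Convex"
begin

text \<open>
  The indicator vectors of the first diagonal block of \<open>S\<close> and of its complement span a plane
  of vectors fixed by \<open>S\<close>. On it
  \<open>I - T\<close> agrees with \<open>S - T\<close>, so it stretches no vector of the plane by more than the Frobenius
  norm of \<open>T - S\<close>. In an orthonormal eigenbasis of \<open>(I - T)\<^sup>T (I - T)\<close> the plane contains a nonzero
  vector orthogonal to the eigenvector of the smallest eigenvalue, and \<open>I - T\<close> stretches that
  vector by at least the second smallest singular value.
\<close>

section \<open>Orthogonal diagonalisation of real symmetric matrices\<close>

lemma symmetric_mat_eigenvalue_exists:
  fixes M :: "real mat"
  assumes M: "M \<in> carrier_mat n n" and sym: "transpose_mat M = M" and n: "n > 0"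
  shows "\<exists>e. eigenvalue M e"
proof -
  \<comment> \<open>Over the complex numbers the spectrum is nonempty. The real and imaginary parts
    \<open>x\<close> and \<open>y\<close> of a complex eigenvector satisfy a coupled real system,
    which decouples once \<open>Im k = 0\<close> is known; whichever of them is nonzero is then a
    real eigenvector.\<close>
  define A where "A = map_mat complex_of_real M"
  have A: "A \<in> carrier_mat n n" using M by (simp add: A_def)
  obtain k z where z: "z \<in> carrier_vec n" "z \<noteq> 0\<^sub>v n" and eig: "A *\<^sub>v z = k \<cdot>\<^sub>v z"
    using spectrum_non_empty[OF A n] A unfolding spectrum_def eigenvalue_def eigenvector_def by auto
  define x where "x = map_vec Re z"
  define y where "y = map_vec Im z"
  have xy: "x \<in> carrier_vec n" "y \<in> carrier_vec n" using z by (auto simp: x_def y_def)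
  have comp: "row A i \<bullet> z = k * z $ i" if "i < n" for i
    using arg_cong[OF eig, of "\<lambda>w. vec_index w i"] that A z by auto
  have Mx: "M *\<^sub>v x = Re k \<cdot>\<^sub>v x - Im k \<cdot>\<^sub>v y"
  proof (rule eq_vecI)
    fix i assume "i < dim_vec (Re k \<cdot>\<^sub>v x - Im k \<cdot>\<^sub>v y)"
    then have i: "i < n" using xy by auto
    have "row M i \<bullet> x = Re (row A i \<bullet> z)"
      using i M z by (simp add: scalar_prod_def A_def x_def)
    then show "(M *\<^sub>v x) $ i = (Re k \<cdot>\<^sub>v x - Im k \<cdot>\<^sub>v y) $ i"
      using i M z comp[OF i] by (simp add: x_def y_def)
  qed (use M xy in auto)
  have My: "M *\<^sub>v y = Im k \<cdot>\<^sub>v x + Re k \<cdot>\<^sub>v y"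
  proof (rule eq_vecI)
    fix i assume "i < dim_vec (Im k \<cdot>\<^sub>v x + Re k \<cdot>\<^sub>v y)"
    then have i: "i < n" using xy by auto
    have "row M i \<bullet> y = Im (row A i \<bullet> z)"
      using i M z by (simp add: scalar_prod_def A_def y_def)
    then show "(M *\<^sub>v y) $ i = (Im k \<cdot>\<^sub>v x + Re k \<cdot>\<^sub>v y) $ i"
      using i M z comp[OF i] by (simp add: x_def y_def)
  qed (use M xy in auto)
  have nz: "x \<noteq> 0\<^sub>v n \<or> y \<noteq> 0\<^sub>v n"
  proof (rule ccontr)
    assume "\<not> ?thesis"
    then have "x $ i = 0 \<and> y $ i = 0" if "i < n" for i using that by simp
    then have "z = 0\<^sub>v n"
      using z by (intro eq_vecI) (auto simp: x_def y_def complex_eq_iff)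
    then show False using z by simp
  qed
  \<comment> \<open>Moving the symmetric \<open>M\<close> across the scalar product cancels the
    \<open>Re k\<close> terms and leaves \<open>Im k\<close> times the sum of the squared lengths of
    \<open>x\<close> and \<open>y\<close>, which is positive.\<close>
  have "(M *\<^sub>v x) \<bullet> y = x \<bullet> (M *\<^sub>v y)"
    using transpose_vec_mult_scalar[OF M xy(2) xy(1)] sym by simp
  then have "Re k * (x \<bullet> y) - Im k * (y \<bullet> y) = Im k * (x \<bullet> x) + Re k * (x \<bullet> y)"
    unfolding Mx My using xy
    by (simp add: minus_scalar_prod_distrib[of _ n] scalar_prod_add_distrib[of _ n])
  then have "Im k * (x \<bullet> x + y \<bullet> y) = 0"
    by (simp add: algebra_simps)
  moreover have "x \<bullet> x \<ge> 0" "y \<bullet> y \<ge> 0"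
    by (auto simp: scalar_prod_def intro!: sum_nonneg)
  moreover have "x \<bullet> x \<noteq> 0 \<or> y \<bullet> y \<noteq> 0"
    using nz conjugate_square_eq_0_vec[OF xy(1)] conjugate_square_eq_0_vec[OF xy(2)] by auto
  ultimately have "Im k = 0"
    by (metis add_nonneg_eq_0_iff mult_eq_0_iff)
  then have "M *\<^sub>v x = Re k \<cdot>\<^sub>v x" "M *\<^sub>v y = Re k \<cdot>\<^sub>v y"
    using xy by (auto simp: Mx My)
  then show ?thesis
    using nz xy M unfolding eigenvalue_def eigenvector_def by auto
qed

text \<open>Gram-Schmidt applied to a basis starting with \<open>v\<close> leaves its first vector
  unchanged, so after normalisation the first column is still a multiple of
  \<open>v\<close>.\<close>

lemma orthogonal_mat_with_first_col:
  fixes v :: "real vec"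
  assumes v: "v \<in> carrier_vec n" and v0: "v \<noteq> 0\<^sub>v n"
  shows "\<exists>P c. P \<in> carrier_mat n n \<and> transpose_mat P * P = 1\<^sub>m n \<and> col P 0 = c \<cdot>\<^sub>v v"
proof -
  have n: "n \<noteq> 0" using v v0 by (intro notI) auto
  interpret cof_vec_space n "TYPE(real)" .
  define b where "b = basis_completion v"
  note bc = basis_completion[OF v v0, folded b_def]
  obtain vs where bv: "b = v # vs" using bc(6,7) n by (cases b) auto
  define ws where "ws = gram_schmidt n b"
  note gs = gram_schmidt_result[OF bc(2) bc(4) bc(5) ws_def]
  have hd: "ws ! 0 = v"
    using gram_schmidt_hd[OF v, of vs] gs(4) bc(6) n
    by (cases ws) (auto simp: ws_def bv)
  have len: "length ws = n" using gs(4) bc(6) by simp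
  have ws: "ws ! i \<in> carrier_vec n" if "i < n" for i
    using gs(3) len that by auto
  define c where "c i = 1 / sqrt (ws ! i \<bullet> ws ! i)" for i
  define P where "P = mat_of_cols n (map (\<lambda>i. c i \<cdot>\<^sub>v ws ! i) [0..<n])"
  have P: "P \<in> carrier_mat n n" by (simp add: P_def carrier_matI)
  have colP: "col P i = c i \<cdot>\<^sub>v ws ! i" if "i < n" for i
    using that ws by (simp add: P_def)
  \<comment> \<open>The case \<open>i = j\<close> of this equivalence says that no vector of
    \<open>ws\<close> vanishes, so the normalising factors \<open>c i\<close> do not divide by
    zero.\<close>
  have orth: "ws ! i \<bullet> ws ! j = 0 \<longleftrightarrow> i \<noteq> j" if "i < n" "j < n" for i j
    using corthogonalD[OF gs(2), of i j] that len by simp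
  have "transpose_mat P * P = 1\<^sub>m n"
  proof (rule eq_matI)
    fix i j assume "i < dim_row (1\<^sub>m n)" "j < dim_col (1\<^sub>m n)"
    then have ij: "i < n" "j < n" by auto
    have "(transpose_mat P * P) $$ (i, j) = c i * c j * (ws ! i \<bullet> ws ! j)"
      using ij P colP ws[OF ij(1)] ws[OF ij(2)] by simp
    moreover have "ws ! i \<bullet> ws ! i > 0"
    proof -
      have "ws ! i \<bullet> ws ! i \<ge> 0" by (auto simp: scalar_prod_def intro!: sum_nonneg)
      then show ?thesis using orth[OF ij(1) ij(1)] by simp
    qed
    ultimately show "(transpose_mat P * P) $$ (i, j) = 1\<^sub>m n $$ (i, j)"
      using ij orth[OF ij] by (auto simp: c_def)
  qed (use P in auto)
  then show ?thesis using P colP[of 0] hd n by auto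
qed

lemma mult_mat_regroup4:
  fixes A :: "'a :: comm_semiring_1 mat"
  assumes "A \<in> carrier_mat n n" "B \<in> carrier_mat n n" "C \<in> carrier_mat n n"
    "D \<in> carrier_mat n n"
  shows "A * B * (C * D) = A * (B * C) * D"
proof -
  note [simp] = assms mult_carrier_mat[of _ n n _ n] assoc_mult_mat[of _ n n _ n _ n]
  show ?thesis by simp
qed

lemma mult_mat_regroup5:
  fixes A :: "'a :: comm_semiring_1 mat"
  assumes "A \<in> carrier_mat n n" "B \<in> carrier_mat n n" "C \<in> carrier_mat n n"
    "D \<in> carrier_mat n n" "E \<in> carrier_mat n n"
  shows "A * (B * C * D) * E = A * B * C * (D * E)"
proof -
  note [simp] = assms mult_carrier_mat[of _ n n _ n] assoc_mult_mat[of _ n n _ n _ n]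
  show ?thesis by simp
qed

text \<open>Induction by deflation: conjugating with an orthogonal matrix whose first column is an
  eigenvector splits off a one by one block, and the remaining block is again symmetric.\<close>

lemma symmetric_mat_spectral:
  fixes M :: "real mat"
  assumes "M \<in> carrier_mat n n" and "transpose_mat M = M"
  shows "\<exists>P D. P \<in> carrier_mat n n \<and> D \<in> carrier_mat n n \<and> transpose_mat P * P = 1\<^sub>m n \<and>
    diagonal_mat D \<and> M = P * D * transpose_mat P"
  using assms
proof (induction n arbitrary: M)
  case 0
  then show ?case
    by (intro exI[of _ "1\<^sub>m 0"] exI[of _ M]) (auto simp: diagonal_mat_def)
next
  case (Suc n)
  note M = Suc.prems(1) and sym = Suc.prems(2)
  let ?N = "Suc n"
  obtain e v where v: "v \<in> carrier_vec ?N" "v \<noteq> 0\<^sub>v ?N" and eig: "M *\<^sub>v v = e \<cdot>\<^sub>v v"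
    using symmetric_mat_eigenvalue_exists[OF M sym] M
    unfolding eigenvalue_def eigenvector_def by auto
  obtain P c where P: "P \<in> carrier_mat ?N ?N" and PP: "transpose_mat P * P = 1\<^sub>m ?N"
    and col0: "col P 0 = c \<cdot>\<^sub>v v"
    using orthogonal_mat_with_first_col[OF v] by blast
  have PP': "P * transpose_mat P = 1\<^sub>m ?N"
    using mat_mult_left_right_inverse[OF _ P PP] P by auto
  define A where "A = transpose_mat P * M * P"
  have A: "A \<in> carrier_mat ?N ?N" using P M by (auto simp: A_def)
  have Asym: "transpose_mat A = A"
  proof -
    have "transpose_mat A = transpose_mat P * transpose_mat (transpose_mat P * M)"
      unfolding A_def using P M by (intro transpose_mult) auto
    also have "transpose_mat (transpose_mat P * M) = M * P"
      using P M sym by (subst transpose_mult[of _ ?N ?N _ ?N]) auto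
    finally show ?thesis
      unfolding A_def using P M by (simp add: assoc_mult_mat[of _ ?N ?N _ ?N _ ?N])
  qed
  \<comment> \<open>\<open>col P 0\<close> is a multiple of the eigenvector \<open>v\<close>, and
    \<open>transpose_mat P\<close> sends it to the first unit vector.\<close>
  have colA: "col A 0 = e \<cdot>\<^sub>v col (1\<^sub>m ?N) 0"
  proof -
    have "col A 0 = transpose_mat P *\<^sub>v (M *\<^sub>v col P 0)"
      using P M by (simp add: A_def assoc_mult_mat[of _ ?N ?N _ ?N _ ?N] col_mult2[of _ ?N ?N _ ?N] del: col_mult)
    also have "M *\<^sub>v col P 0 = e \<cdot>\<^sub>v col P 0"
      using mult_mat_vec[OF M v(1)] v eig by (simp add: col0 smult_smult_assoc mult.commute)
    also have "transpose_mat P *\<^sub>v (e \<cdot>\<^sub>v col P 0) = e \<cdot>\<^sub>v (transpose_mat P *\<^sub>v col P 0)"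
      using P by (intro mult_mat_vec[of _ ?N ?N] carrier_vecI) simp_all
    also have "transpose_mat P *\<^sub>v col P 0 = col (transpose_mat P * P) 0"
      using P by (subst col_mult2[of _ ?N ?N _ ?N]) auto
    finally show ?thesis by (simp add: PP)
  qed
  have A0: "A $$ (i, 0) = (if i = 0 then e else 0)" if "i < ?N" for i
    using arg_cong[OF colA, of "\<lambda>w. vec_index w i"] that A by auto
  \<comment> \<open>Symmetry carries the zeros of the first column over to the first row, so
    \<open>A\<close> is the direct sum of the entry \<open>e\<close> and the block
    \<open>B\<close>.\<close>
  have A0': "A $$ (0, i) = (if i = 0 then e else 0)" if "i < ?N" for i
    using A0[OF that] arg_cong[OF Asym, of "\<lambda>B. B $$ (i, 0)"] that A by auto
  define B where "B = mat n n (\<lambda>(i, j). A $$ (Suc i, Suc j))"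
  have B: "B \<in> carrier_mat n n" by (simp add: B_def)
  have "transpose_mat B = B"
  proof (rule eq_matI)
    fix i j assume "i < dim_row B" "j < dim_col B"
    then show "transpose_mat B $$ (i, j) = B $$ (i, j)"
      using arg_cong[OF Asym, of "\<lambda>B. B $$ (Suc i, Suc j)"] A by (auto simp: B_def)
  qed (auto simp: B_def)
  from Suc.IH[OF B this] obtain Q D where Q: "Q \<in> carrier_mat n n" and D: "D \<in> carrier_mat n n"
    and QQ: "transpose_mat Q * Q = 1\<^sub>m n" and diag: "diagonal_mat D"
    and BQ: "B = Q * D * transpose_mat Q" by blast
  let ?E = "mat 1 1 (\<lambda>_. e)"
  let ?Q = "four_block_mat (1\<^sub>m 1) (0\<^sub>m 1 n) (0\<^sub>m n 1) Q"
  let ?D = "four_block_mat ?E (0\<^sub>m 1 n) (0\<^sub>m n 1) D"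
  have Qt: "transpose_mat ?Q = four_block_mat (1\<^sub>m 1) (0\<^sub>m 1 n) (0\<^sub>m n 1) (transpose_mat Q)"
    using Q by (subst transpose_four_block_mat[of _ 1 1 _ n _ n]) auto
  have Qc: "?Q \<in> carrier_mat ?N ?N" and Dc: "?D \<in> carrier_mat ?N ?N"
    using four_block_carrier_mat[OF one_carrier_mat[of 1] Q]
      four_block_carrier_mat[OF mat_carrier[of 1 1] D] by simp_all
  have "?Q * ?D = four_block_mat ?E (0\<^sub>m 1 n) (0\<^sub>m n 1) (Q * D)"
    using Q D by (subst mult_four_block_mat[of _ 1 1 _ n _ n _ _ 1 _ n]) auto
  then have "?Q * ?D * transpose_mat ?Q = four_block_mat ?E (0\<^sub>m 1 n) (0\<^sub>m n 1) B"
    using Q D unfolding Qt BQ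
    by (simp, subst mult_four_block_mat[of _ 1 1 _ n _ n _ _ 1 _ n]) auto
  also have "\<dots> = A"
    using A by (intro eq_matI) (auto simp: A0 A0' B_def)
  finally have AQ: "A = ?Q * ?D * transpose_mat ?Q" by simp
  have QQ': "transpose_mat ?Q * ?Q = 1\<^sub>m ?N"
    unfolding Qt using Q QQ
    by (subst mult_four_block_mat[of _ 1 1 _ n _ n _ _ 1 _ n]) auto
  \<comment> \<open>Inserting \<open>P * transpose_mat P\<close> on both sides undoes the
    conjugation and shows that \<open>P * ?Q\<close> diagonalises \<open>M\<close>.\<close>
  have "M = (P * transpose_mat P) * M * (P * transpose_mat P)"
    unfolding PP' using M by simp
  also have "\<dots> = P * A * transpose_mat P"
    unfolding A_def by (rule mult_mat_regroup5[OF P _ M P, symmetric]) (use P in auto)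
  also have "\<dots> = (P * ?Q) * ?D * transpose_mat (P * ?Q)"
    unfolding AQ transpose_mult[OF P Qc]
    by (rule mult_mat_regroup5[OF P Qc Dc]) (use P Qc in auto)
  finally have "M = (P * ?Q) * ?D * transpose_mat (P * ?Q)" .
  moreover have "transpose_mat (P * ?Q) * (P * ?Q) = 1\<^sub>m ?N"
  proof -
    have "transpose_mat (P * ?Q) * (P * ?Q) = transpose_mat ?Q * (transpose_mat P * P) * ?Q"
      unfolding transpose_mult[OF P Qc]
      by (rule mult_mat_regroup4[OF _ _ P Qc]) (use P Qc in auto)
    also have "\<dots> = 1\<^sub>m ?N"
      unfolding PP using right_mult_one_mat[of "transpose_mat ?Q" ?N ?N] Qc QQ' by simp
    finally show ?thesis .
  qed
  moreover have "diagonal_mat ?D"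
    using diag D unfolding diagonal_mat_def by auto
  ultimately show ?case
    using P Qc Dc by (intro exI[of _ "P * ?Q"] exI[of _ ?D]) auto
qed

section \<open>Eigenvalues with multiplicity and the second smallest of them\<close>

lemma proots_linear_factors:
  fixes es :: "'a :: idom list"
  shows "proots (\<Prod>e\<leftarrow>es. [:- e, 1:]) = mset es"
proof -
  have "[:- e, 1:] \<noteq> 0" for e :: 'a by simp
  then have "0 \<notin> set (map (\<lambda>e. [:- e, 1:]) es)"
    by (metis (no_types, lifting) imageE list.set_map)
  from proots_prod_list[OF this]
  have "proots (\<Prod>e\<leftarrow>es. [:- e, 1:]) = (\<Sum>e\<leftarrow>es. {#e#})"
    by (simp add: comp_def)
  also have "\<dots> = mset es"
    by (induction es) auto
  finally show ?thesis .
qed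

text \<open>In the sorted list only index 0 can hold an entry strictly below the one at index 1, and
  sorting preserves the number of such entries. Positions are compared rather than values, so
  repeated entries count with multiplicity.\<close>

lemma less_second_smallest_unique:
  fixes es :: "'a :: linorder list"
  assumes "2 \<le> length es" "i < length es" "j < length es"
    "es ! i < sort es ! 1" "es ! j < sort es ! 1"
  shows "i = j"
proof -
  let ?m = "sort es ! 1"
  have "filter (\<lambda>e. e < ?m) (sort es) = filter (\<lambda>e. e < ?m) (take 1 (sort es) @ drop 1 (sort es))"
    by simp
  also have "\<dots> = filter (\<lambda>e. e < ?m) (take 1 (sort es))"
  proof -
    have "?m \<le> e" if "e \<in> set (drop 1 (sort es))" for e
    proof -
      from that obtain k where "k < length es - 1" "e = sort es ! Suc k"
        by (auto simp: in_set_conv_nth)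
      then show ?thesis using sorted_nth_mono[OF sorted_sort, of 1 "Suc k" es] by simp
    qed
    then have "filter (\<lambda>e. e < ?m) (drop 1 (sort es)) = []"
      by (auto simp: filter_empty_conv not_less)
    then show ?thesis by (simp only: filter_append append_Nil2)
  qed
  finally have "length (filter (\<lambda>e. e < ?m) (sort es)) \<le> 1"
    by (metis length_filter_le length_take min.cobounded2 order.trans)
  moreover have "length (filter (\<lambda>e. e < ?m) (sort es)) = length (filter (\<lambda>e. e < ?m) es)"
    by (metis mset_filter mset_sort size_mset)
  ultimately have "card {i. i < length es \<and> es ! i < ?m} \<le> 1"
    by (simp add: length_filter_conv_card)
  moreover have "finite {i. i < length es \<and> es ! i < ?m}" by simp
  ultimately have "\<forall>i\<in>{i. i < length es \<and> es ! i < ?m}. \<forall>j\<in>{i. i < length es \<and> es ! i < ?m}. i = j"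
    by (simp only: card_le_Suc0_iff_eq One_nat_def)
  then show ?thesis using assms(2-5) by blast
qed

lemma orthogonally_diagonalised_proots:
  fixes P :: "real mat"
  assumes P: "P \<in> carrier_mat n n" and D: "D \<in> carrier_mat n n"
    and PP: "transpose_mat P * P = 1\<^sub>m n" and diag: "diagonal_mat D"
  shows "proots (char_poly (P * D * transpose_mat P)) = mset (diag_mat D)"
proof -
  have "P * transpose_mat P = 1\<^sub>m n"
    using mat_mult_left_right_inverse[OF _ P PP] P by auto
  then have "similar_mat (P * D * transpose_mat P) D"
    unfolding similar_mat_def using P D PP
    by (intro exI[of _ P] exI[of _ "transpose_mat P"] similar_mat_witI[of _ _ n]) auto
  moreover have "upper_triangular D"
    using diag D by (auto simp: diagonal_mat_def)
  ultimately show ?thesis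
    using char_poly_similar char_poly_upper_triangular[OF D] proots_linear_factors by metis
qed

text \<open>All roots are real by the spectral theorem. The exact count is what later converts
  positions in the decreasing list of singular values into positions in the increasing list of
  eigenvalues.\<close>

lemma symmetric_mat_size_proots:
  fixes M :: "real mat"
  assumes "M \<in> carrier_mat n n" and "transpose_mat M = M"
  shows "size (proots (char_poly M)) = n"
proof -
  obtain P D where PD: "P \<in> carrier_mat n n" "D \<in> carrier_mat n n" "transpose_mat P * P = 1\<^sub>m n"
    "diagonal_mat D" "M = P * D * transpose_mat P"
    using symmetric_mat_spectral[OF assms] by blast
  then have "proots (char_poly M) = mset (diag_mat D)"
    using orthogonally_diagonalised_proots by blast
  then show ?thesis using PD(2) by (simp add: diag_mat_def)
qed

text \<open>One inequality of the Courant-Fischer min-max principle, with the plane given by the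
  basis \<open>u\<close>, \<open>w\<close>: the largest Rayleigh quotient on a plane is at least the
  second smallest eigenvalue.\<close>

lemma second_smallest_eigenvalue_le:
  fixes M :: "real mat"
  assumes M: "M \<in> carrier_mat n n" and sym: "transpose_mat M = M" and n: "2 \<le> n"
    and u: "u \<in> carrier_vec n" and w: "w \<in> carrier_vec n"
    and indep: "\<And>a b. a \<cdot>\<^sub>v u + b \<cdot>\<^sub>v w = 0\<^sub>v n \<Longrightarrow> a = 0 \<and> b = 0"
    and bound: "\<And>a b x. x = a \<cdot>\<^sub>v u + b \<cdot>\<^sub>v w \<Longrightarrow> x \<bullet> (M *\<^sub>v x) \<le> c * (x \<bullet> x)"
  shows "sorted_list_of_multiset (proots (char_poly M)) ! 1 \<le> c"
proof -
  obtain P D where P: "P \<in> carrier_mat n n" and D: "D \<in> carrier_mat n n"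
    and PP: "transpose_mat P * P = 1\<^sub>m n" and diag: "diagonal_mat D"
    and MP: "M = P * D * transpose_mat P"
    using symmetric_mat_spectral[OF M sym] by blast
  have PP': "P * transpose_mat P = 1\<^sub>m n"
    using mat_mult_left_right_inverse[OF _ P PP] P by auto
  define es where "es = diag_mat D"
  have len: "length es = n" using D by (simp add: es_def diag_mat_def)
  have sorted: "sorted_list_of_multiset (proots (char_poly M)) = sort es"
    unfolding MP orthogonally_diagonalised_proots[OF P D PP diag] es_def
    by (rule sorted_list_of_multiset_mset)
  define m where "m = sort es ! 1"
  \<comment> \<open>\<open>k\<close> is the only position whose eigenvalue may lie below
    \<open>m\<close>. If no eigenvalue does, any position serves, and 0 is taken.\<close>
  obtain k where k: "k < n" and large: "\<And>i. i < n \<Longrightarrow> i \<noteq> k \<Longrightarrow> m \<le> es ! i"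
  proof (cases "\<exists>k<n. es ! k < m")
    case True
    then obtain k where "k < n" "es ! k < m" by blast
    then show ?thesis
      using that[of k] less_second_smallest_unique[of es _ k] len n unfolding m_def
      by (meson leI)
  next
    case False
    then have "m \<le> es ! i" if "i < n" for i
      using that by (meson not_less)
    then show ?thesis using that[of 0] n by auto
  qed
  define p where "p = col P k"
  have p: "p \<in> carrier_vec n" unfolding p_def using P by (intro carrier_vecI) simp
  \<comment> \<open>One homogeneous linear equation in two unknowns: swapping the coefficients and
    changing one sign solves it, unless both coefficients vanish and every pair is a
    solution.\<close>
  obtain a b where ab: "a \<noteq> 0 \<or> b \<noteq> 0" and perp: "a * (p \<bullet> u) + b * (p \<bullet> w) = 0"
  proof (cases "p \<bullet> u = 0 \<and> p \<bullet> w = 0")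
    case True
    then show ?thesis using that[of 1 0] by simp
  next
    case False
    then show ?thesis using that[of "p \<bullet> w" "- (p \<bullet> u)"] by (auto simp: mult.commute)
  qed
  define x where "x = a \<cdot>\<^sub>v u + b \<cdot>\<^sub>v w"
  have x: "x \<in> carrier_vec n" using u w by (simp add: x_def)
  have "x \<noteq> 0\<^sub>v n" using indep ab by (auto simp: x_def)
  then have "x \<bullet> x \<noteq> 0" using conjugate_square_eq_0_vec[OF x] by simp
  moreover have "x \<bullet> x \<ge> 0" by (auto simp: scalar_prod_def intro!: sum_nonneg)
  ultimately have xx: "x \<bullet> x > 0" by simp
  \<comment> \<open>\<open>y\<close> holds the coordinates of \<open>x\<close> in the eigenbasis. By
    the choice of \<open>a\<close> and \<open>b\<close> its coordinate \<open>k\<close> is zero, so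
    the one eigenvalue that may be below \<open>m\<close> gets weight zero in the quadratic
    form.\<close>
  define y where "y = transpose_mat P *\<^sub>v x"
  have y: "y \<in> carrier_vec n" unfolding y_def using P by (intro carrier_vecI) simp
  have yk: "y $ k = 0"
    using P k p u w perp by (simp add: y_def p_def[symmetric] x_def scalar_prod_add_distrib[of _ n])
  have Dy: "(D *\<^sub>v y) $ i = es ! i * y $ i" if "i < n" for i
  proof -
    have "(D *\<^sub>v y) $ i = (\<Sum>j\<in>{0..<n}. D $$ (i, j) * y $ j)"
      using that D y by (simp add: scalar_prod_def)
    also have "\<dots> = (\<Sum>j\<in>{i}. D $$ (i, j) * y $ j)"
      using that diag D by (intro sum.mono_neutral_right) (auto simp: diagonal_mat_def)
    also have "\<dots> = es ! i * y $ i" using that D by (simp add: es_def diag_mat_def)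
    finally show ?thesis .
  qed
  have Dyc: "D *\<^sub>v y \<in> carrier_vec n" using D by (intro carrier_vecI) simp
  have "M *\<^sub>v x = P *\<^sub>v (D *\<^sub>v y)"
    unfolding MP y_def using P D x by (simp add: assoc_mult_mat_vec[of _ n n _ n])
  then have "x \<bullet> (M *\<^sub>v x) = y \<bullet> (D *\<^sub>v y)"
    using transpose_vec_mult_scalar[OF P Dyc x] by (simp add: y_def)
  also have "\<dots> = (\<Sum>i\<in>{0..<n}. es ! i * (y $ i)\<^sup>2)"
    unfolding scalar_prod_def using D Dyc Dy
    by (intro sum.cong) (auto simp: power2_eq_square carrier_vecD[OF Dyc] simp del: index_mult_mat_vec)
  also have "\<dots> \<ge> (\<Sum>i\<in>{0..<n}. m * (y $ i)\<^sup>2)"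
  proof (rule sum_mono)
    fix i assume "i \<in> {0..<n}"
    then show "m * (y $ i)\<^sup>2 \<le> es ! i * (y $ i)\<^sup>2"
      using large[of i] yk by (cases "i = k") (auto intro: mult_right_mono)
  qed
  also have "(\<Sum>i\<in>{0..<n}. m * (y $ i)\<^sup>2) = m * (y \<bullet> y)"
    using y by (simp add: scalar_prod_def sum_distrib_left power2_eq_square)
  also have "y \<bullet> y = x \<bullet> x"
  proof -
    have "y \<bullet> y = x \<bullet> (P *\<^sub>v y)"
      using transpose_vec_mult_scalar[OF P y x] by (simp add: y_def)
    also have "P *\<^sub>v y = (P * transpose_mat P) *\<^sub>v x"
      using P x by (simp add: y_def assoc_mult_mat_vec[of _ n n _ n])
    finally show ?thesis using x by (simp add: PP')
  qed
  finally have "m * (x \<bullet> x) \<le> c * (x \<bullet> x)" using bound[OF x_def] by linarith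
  then show ?thesis using xx by (simp add: sorted m_def)
qed

section \<open>Singular values, row sums of block matrices and the Frobenius norm\<close>

lemma singular_value_eq_sqrt:
  assumes A: "A \<in> carrier_mat n n" and k: "1 \<le> k" "k \<le> n"
  shows "singular_value A k =
    sqrt (sorted_list_of_multiset (proots (char_poly (transpose_mat A * A))) ! (n - k))"
proof -
  define X where "X = proots (char_poly (transpose_mat A * A))"
  have "size X = n" unfolding X_def
    by (rule symmetric_mat_size_proots) (use A transpose_mult[of "transpose_mat A" n n A n] in auto)
  then have len: "length (sorted_list_of_multiset X) = n"
    by (metis mset_sorted_list_of_multiset size_mset)
  \<comment> \<open>\<open>sqrt\<close> is monotone on all reals, being extended as an odd function,
    so it commutes with sorting whatever the signs of the roots.\<close>
  have "sorted_list_of_multiset (image_mset sqrt X) = map sqrt (sorted_list_of_multiset X)"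
    by (rule properties_for_sort[of _ "sorted_list_of_multiset (image_mset sqrt X)",
          unfolded sorted_sort_id[OF sorted_sorted_list_of_multiset]])
      (auto simp: sorted_map intro: sorted_wrt_mono_rel[OF _ sorted_sorted_list_of_multiset])
  then show ?thesis
    using len k by (simp add: singular_value_def singular_values_def X_def[symmetric] rev_nth)
qed

lemma sum_lessThan_add:
  fixes f :: "nat \<Rightarrow> 'a :: comm_monoid_add"
  shows "(\<Sum>j<k + l. f j) = (\<Sum>j<k. f j) + (\<Sum>j<l. f (k + j))"
  by (induction l) (auto simp: ac_simps)

lemma diag_block_stochastic_row_sum:
  assumes "\<forall>B\<in>set Bs. stochastic_mat B" and "i < dim_row (diag_block_mat Bs)"
  shows "(\<Sum>j<dim_col (diag_block_mat Bs). diag_block_mat Bs $$ (i, j)) = 1"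
  using assms
proof (induction Bs arbitrary: i)
  case (Cons B Bs)
  show ?case
  proof (cases "i < dim_row B")
    case True
    then show ?thesis
      using Cons.prems by (auto simp: Let_def sum_lessThan_add stochastic_mat_def)
  next
    case False
    have "(\<Sum>j<dim_col (diag_block_mat Bs). diag_block_mat Bs $$ (i - dim_row B, j)) = 1"
      using Cons.prems False by (intro Cons.IH) (auto simp: Let_def)
    then show ?thesis
      using Cons.prems False by (auto simp: Let_def sum_lessThan_add stochastic_mat_def)
  qed
qed simp

text \<open>Cauchy-Schwarz in each row of \<open>A\<close>, summed over the rows.\<close>

lemma frobenius_norm_bound:
  fixes A :: "real mat"
  assumes A: "A \<in> carrier_mat m n" and x: "x \<in> carrier_vec n"
  shows "(A *\<^sub>v x) \<bullet> (A *\<^sub>v x) \<le> (frobenius_norm A)\<^sup>2 * (x \<bullet> x)"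
proof -
  have xx: "x \<bullet> x = (\<Sum>j<n. (x $ j)\<^sup>2)"
    using x by (simp add: scalar_prod_def power2_eq_square atLeast0LessThan)
  have "(A *\<^sub>v x) \<bullet> (A *\<^sub>v x) = (\<Sum>i<m. (\<Sum>j<n. A $$ (i, j) * x $ j)\<^sup>2)"
    using A x by (simp add: scalar_prod_def power2_eq_square atLeast0LessThan)
  also have "\<dots> \<le> (\<Sum>i<m. (\<Sum>j<n. (A $$ (i, j))\<^sup>2) * (\<Sum>j<n. (x $ j)\<^sup>2))"
    by (intro sum_mono Cauchy_Schwarz_ineq_sum)
  also have "\<dots> = (frobenius_norm A)\<^sup>2 * (x \<bullet> x)"
    using A unfolding xx by (simp add: frobenius_norm_def sum_nonneg sum_distrib_right)
  finally show ?thesis .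
qed

section \<open>Vectors fixed by a decoupled chain and the resulting bound\<close>

theorem theorem2p16:
  fixes n :: nat and T S :: "real mat" and \<sigma> :: real
  assumes "T \<in> carrier_mat n n" and "stochastic_mat T"
    and "\<sigma> = singular_value (1\<^sub>m n - T) (n - 1)"
    and "S \<in> carrier_mat n n" and "completely_decoupled S"
  shows "frobenius_norm (T - S) \<ge> \<sigma>"
proof -
  note T = assms(1) and S = assms(4)
  obtain Bs0 where Bs0: "2 \<le> length Bs0" "\<forall>B\<in>set Bs0. stochastic_mat B" "S = diag_block_mat Bs0"
    using assms(5) unfolding completely_decoupled_def by blast
  obtain B B' Bs where Bs0': "Bs0 = B # B' # Bs"
    using Bs0(1) by (cases Bs0; cases "tl Bs0") auto
  \<comment> \<open>All blocks after the first are merged into one. Keeping \<open>B'\<close>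
    explicit ensures \<open>l > 0\<close>, since stochastic matrices are nonempty by
    definition.\<close>
  define D where "D = diag_block_mat (B' # Bs)"
  define k where "k = dim_row B"
  define l where "l = dim_row D"
  have B: "B \<in> carrier_mat k k" and k: "k > 0"
    and B1: "\<And>i. i < k \<Longrightarrow> (\<Sum>j<k. B $$ (i, j)) = 1"
    using Bs0(2) by (auto simp: Bs0' stochastic_mat_def k_def)
  have "square_mat D"
    unfolding D_def using Bs0(2) by (intro diag_block_mat_square) (auto simp: Bs0' stochastic_mat_def)
  then have D: "D \<in> carrier_mat l l" by (auto simp: l_def)
  have l: "l > 0"
    using Bs0(2) by (simp add: l_def D_def dim_diag_block_mat Bs0' stochastic_mat_def)
  have D1: "(\<Sum>j<l. D $$ (i, j)) = 1" if "i < l" for i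
    using diag_block_stochastic_row_sum[of "B' # Bs" i] that Bs0(2) D
    by (auto simp: Bs0' D_def[symmetric] simp del: diag_block_mat.simps)
  have SB: "S = four_block_mat B (0\<^sub>m k l) (0\<^sub>m l k) D"
    using B D unfolding Bs0(3) Bs0' diag_block_mat.simps(2)[of B] D_def[symmetric]
    by (simp add: Let_def)
  have n: "n = k + l" using S B D by (auto simp: SB)
  define u :: "real vec" where "u = vec n (\<lambda>i. if i < k then 1 else 0)"
  define w :: "real vec" where "w = vec n (\<lambda>i. if i < k then 0 else 1)"
  have u: "u \<in> carrier_vec n" and w: "w \<in> carrier_vec n" by (auto simp: u_def w_def)
  have Su: "S *\<^sub>v u = u"
    using B D B1 D1 by (intro eq_vecI)
      (auto simp: SB u_def n scalar_prod_def atLeast0LessThan sum_lessThan_add)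
  have Sw: "S *\<^sub>v w = w"
    using B D B1 D1 by (intro eq_vecI)
      (auto simp: SB w_def n scalar_prod_def atLeast0LessThan sum_lessThan_add)
  define A where "A = 1\<^sub>m n - T"
  have A: "A \<in> carrier_mat n n" using T by (auto simp: A_def)
  have TS: "T - S \<in> carrier_mat n n" using T S by auto
  let ?F = "frobenius_norm (T - S)"
  have "sorted_list_of_multiset (proots (char_poly (transpose_mat A * A))) ! 1 \<le> ?F\<^sup>2"
  proof (rule second_smallest_eigenvalue_le[OF _ _ _ u w])
    fix a b assume 0: "a \<cdot>\<^sub>v u + b \<cdot>\<^sub>v w = 0\<^sub>v n"
    show "a = 0 \<and> b = 0"
      \<comment> \<open>Coordinates 0 and \<open>k\<close> are the first ones of the two blocks and
        read off \<open>a\<close> and \<open>b\<close>.\<close>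
      using arg_cong[OF 0, of "\<lambda>z. vec_index z 0"] arg_cong[OF 0, of "\<lambda>z. vec_index z k"] k l
      by (simp add: u_def w_def n)
  next
    fix a b x assume xdef: "x = a \<cdot>\<^sub>v u + b \<cdot>\<^sub>v w"
    have x: "x \<in> carrier_vec n" using u w by (simp add: xdef)
    have Sx: "S *\<^sub>v x = x"
      using S u w Su Sw
      by (simp add: xdef mult_add_distrib_mat_vec[of _ n n] mult_mat_vec[of _ n n])
    \<comment> \<open>Since \<open>S\<close> fixes \<open>x\<close>, the identity in
      \<open>A\<close> may be replaced by \<open>S\<close>. The sign disappears in the squared
      length.\<close>
    have Ax: "A *\<^sub>v x = - ((T - S) *\<^sub>v x)"
      using T S x Sx by (intro eq_vecI)
        (auto simp: A_def minus_mult_distrib_mat_vec[of _ n n] simp del: index_mult_mat_vec)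
    have "x \<bullet> ((transpose_mat A * A) *\<^sub>v x) = (A *\<^sub>v x) \<bullet> (A *\<^sub>v x)"
      using transpose_vec_mult_scalar[of "transpose_mat A" n n "A *\<^sub>v x" x] A x
      by (simp add: assoc_mult_mat_vec[of _ n n _ n])
    also have "\<dots> = ((T - S) *\<^sub>v x) \<bullet> ((T - S) *\<^sub>v x)"
      unfolding Ax using S by (simp add: scalar_prod_def)
    also have "\<dots> \<le> ?F\<^sup>2 * (x \<bullet> x)" by (rule frobenius_norm_bound[OF TS x])
    finally show "x \<bullet> ((transpose_mat A * A) *\<^sub>v x) \<le> ?F\<^sup>2 * (x \<bullet> x)" .
  qed (use A k l n transpose_mult[of "transpose_mat A" n n A n] in auto)
  then have "sqrt (sorted_list_of_multiset (proots (char_poly (transpose_mat A * A))) ! 1) \<le> ?F"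
    by (intro real_le_lsqrt) (auto simp: frobenius_norm_def sum_nonneg)
  \<comment> \<open>The singular value numbered \<open>n - 1\<close> from the top sits at index
    \<open>n - (n - 1) = 1\<close> from the bottom, counting from 0; both blocks being nonempty
    gives \<open>n\<close> at least 2.\<close>
  moreover have "\<sigma> = sqrt (sorted_list_of_multiset (proots (char_poly (transpose_mat A * A))) ! 1)"
    unfolding assms(3) A_def[symmetric] using singular_value_eq_sqrt[OF A, of "n - 1"] k l n by simp
  ultimately show ?thesis by simp
qed

end
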